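(* Let $-\infty<L<\infty$ and let $p:\mathbb{R}\to[0,\infty)$ be a probability density function with support $[L,\infty)$ and distribution function $P$, satisfying the following conditions. (i) $p$ is continuous and positive on $(L,\infty)$, and there are finitely many points $L<y_1<\dots<y_m<\infty$ ($m\ge 0$) such that $p$ is continuously differentiable on each component interval of $S(p)=(L,\infty)\setminus\{y_1,\dots,y_m\}$. (ii) $\sup_{x\in S(p)}\left|\frac{p'(x)\min\{P(x),1-P(x)\}}{p^2(x)}\right|<\infty$. (iii) $\int_{S(p)}(1+|x|)\,|p'(x)|\,\mathrm{d}x<\infty$. (iv) $\lim_{x\searrow L}\frac{P(x)}{p(x)}=0$. Let $X:\Omega\to(L,\infty)$ be a random variable with $\mathbb{P}(X\in S(p))=1$, $\mathbb{E}\left|\frac{p'(X)}{p(X)}\right|<\infty$ and $\mathbb{E}\left|\frac{p'(X)}{p(X)}X\right|<\infty$. Then $X$ has Lebesgue density $p$ if, and only if, the distribution function $F_X$ of $X$ satisfies $$F_X(t)=\mathbb{E}\left[-\frac{p'(X)}{p(X)}\Big(\min\{X,t\}-L\Big)\right],\quad t>L.$$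
   Context: $(\Omega,\mathcal{A},\mathbb{P})$ is a probability space. $F_X(t)=\mathbb{P}(X\le t)$ is the distribution function of $X$. "$X$ has Lebesgue density $p$" means that the law of $X$ is $p\,\mathcal{L}^1$, where $\mathcal{L}^1$ is Lebesgue measure on $\mathbb{R}$. $P(x)=\int_{L}^x p(s)\,\mathrm{d}s$ for $x\ge L$. The case $m=0$ is allowed. *)

theory Defs
  imports "HOL-Probability.Probability"
begin

definition smooth_set :: "real \<Rightarrow> nat \<Rightarrow> (nat \<Rightarrow> real) \<Rightarrow> real set" where
  "smooth_set L m y = {L<..} - y ` {1..m}"

text \<open>The distribution function of a density vanishing to the left of \<open>L\<close>.\<close>

definition dist_fun :: "real \<Rightarrow> (real \<Rightarrow> real) \<Rightarrow> real \<Rightarrow> real" where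
  "dist_fun L p x = (LINT s:{L..x}|lborel. p s)"

text \<open>The support is the closure of the set where the function is positive, so the value
  \<open>p L\<close> is unconstrained (apart from being nonnegative).\<close>

definition pdf_with_support :: "(real \<Rightarrow> real) \<Rightarrow> real set \<Rightarrow> bool" where
  "pdf_with_support p A \<longleftrightarrow>
     p \<in> borel_measurable borel \<and> (\<forall>x. 0 \<le> p x) \<and>
     (\<integral>\<^sup>+x. ennreal (p x) \<partial>lborel) = 1 \<and> closure {x. 0 < p x} = A"

end

theory Submission
  imports Defs
begin

text \<open>
  Write \<open>k = - p' / p\<close> on \<open>S\<close> (and \<open>0\<close> elsewhere), let \<open>\<mu>\<close> be the law of \<open>X\<close>, and let
  \<open>q s\<close> be the tail integral of \<open>k\<close> over \<open>{s<..}\<close> with respect to \<open>\<mu>\<close>. For \<open>x > L\<close> the number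
  \<open>min x t - L\<close> is the length of the set of all \<open>s\<close> with \<open>L < s \<le> t\<close> and \<open>s < x\<close>. By Fubini's
  theorem (\<open>tail_integral_mixture\<close>) the expectation in the characterization is therefore the
  integral of \<open>q\<close> over \<open>{L<..t}\<close>, and the characterization says that \<open>q\<close> is a density of \<open>\<mu>\<close>.

  If \<open>\<mu>\<close> has density \<open>p\<close>, then \<open>q s\<close> is minus the integral of \<open>p'\<close> over \<open>{s<..}\<close>, so \<open>q\<close> and
  \<open>p\<close> have the same derivative off the exceptional points. They differ by a constant, which is
  the limit of \<open>p\<close> at infinity and hence zero (\<open>tail_integral_neg_score\<close>); so \<open>q = p\<close>.

  Conversely, let \<open>F\<close> be the distribution function of \<open>X\<close> and assume that \<open>F t\<close> is the
  integral of \<open>q\<close> over \<open>{L<..t}\<close> for all \<open>t > L\<close>. Since \<open>q\<close> is right-continuous and \<open>F\<close> is nondecreasing, \<open>q\<close> is nonnegative and \<open>\<mu>\<close> has density \<open>q\<close>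
  (\<open>real_distribution_eq_density\<close>). Inserting this into the definition of \<open>q\<close> gives the fixed
  point equation \<open>q s = (integral of k q over {s<..})\<close>. Its solutions are continuous and satisfy
  \<open>q' = (p' / p) q\<close> off finitely many points, so \<open>q / p\<close> is constant
  (\<open>tail_fixed_point_proportional\<close>), and the constant is \<open>1\<close> because both are probability
  densities.
\<close>

section \<open>Tail integrals\<close>

text \<open>
  For \<open>x > L\<close> the factor \<open>min x t - L\<close> is the integral over \<open>s\<close> of the indicator of
  \<open>L < s \<le> t\<close>, \<open>s < x\<close>. Exchanging the two integrals is allowed because the integrand is
  dominated by \<open>\<bar>k x\<bar>\<close> and \<open>s\<close> ranges over an interval of finite length \<open>t - L\<close>.
\<close>

lemma tail_integral_mixture:
  fixes k :: "real \<Rightarrow> real" and L t :: real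
  assumes "prob_space \<mu>" and [measurable_cong]: "sets \<mu> = sets borel"
    and k: "integrable \<mu> k" and supp: "AE x in \<mu>. L < x" and "L < t"
  shows "set_integrable lborel {L<..t} (\<lambda>s. LINT x:{s<..}|\<mu>. k x)"
    and "(LINT s:{L<..t}|lborel. LINT x:{s<..}|\<mu>. k x) = (LINT x|\<mu>. k x * (min x t - L))"
proof -
  interpret prob_space \<mu> by fact
  interpret pair_sigma_finite \<mu> lborel ..
  let ?f = "\<lambda>x s. indicator {L<..t} s * (indicator {s<..} x * k x)"
  have [measurable]: "k \<in> borel_measurable borel"
    using borel_measurable_integrable[OF k] by measurable
  have meas [measurable]: "case_prod ?f \<in> borel_measurable (\<mu> \<Otimes>\<^sub>M lborel)"
  proof -
    have "(\<lambda>z. if L < snd z \<and> snd z \<le> t \<and> snd z < fst z then k (fst z) else 0)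
        \<in> borel_measurable (\<mu> \<Otimes>\<^sub>M lborel)"
      by measurable
    also have "(\<lambda>z. if L < snd z \<and> snd z \<le> t \<and> snd z < fst z then k (fst z) else 0) = case_prod ?f"
      by (auto simp: fun_eq_iff indicator_def)
    finally show ?thesis .
  qed
  have inner: "(LINT s|lborel. ?f x s) = k x * (min x t - L)"
    and inner_abs: "(LINT s|lborel. norm (?f x s)) = \<bar>k x\<bar> * (min x t - L)"
    and inner_int: "integrable lborel (?f x)" if "L < x" for x
  proof -
    have *: "indicator {L<..t} s * indicator {s<..} x = (indicator ({L<..t} \<inter> {..<x}) s :: real)" for s
      by (auto simp: indicator_def)
    have f: "?f x s = indicator ({L<..t} \<inter> {..<x}) s * k x" for s
      unfolding *[symmetric] by (simp only: mult_ac)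
    have f_abs: "norm (?f x s) = indicator ({L<..t} \<inter> {..<x}) s * \<bar>k x\<bar>" for s
      unfolding f by (simp add: abs_mult)
    have fin: "emeasure lborel ({L<..t} \<inter> {..<x}) < \<infinity>"
      by (rule le_less_trans[OF emeasure_mono[of _ "{L<..t}"]]) (use \<open>L < t\<close> in auto)
    have len: "measure lborel ({L<..t} \<inter> {..<x}) = min x t - L"
    proof (cases "x \<le> t")
      case True
      then have "{L<..t} \<inter> {..<x} = {L<..<x}" by auto
      with True that show ?thesis by simp
    next
      case False
      then have "{L<..t} \<inter> {..<x} = {L<..t}" by auto
      with False \<open>L < t\<close> show ?thesis by simp
    qed
    show "(LINT s|lborel. ?f x s) = k x * (min x t - L)"
      unfolding f using fin len by simp
    show "(LINT s|lborel. norm (?f x s)) = \<bar>k x\<bar> * (min x t - L)"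
      unfolding f_abs using fin len by simp
    show "integrable lborel (?f x)"
      unfolding f using fin by (intro integrable_mult_left integrable_real_indicator) auto
  qed
  have "integrable \<mu> (\<lambda>x. \<bar>k x\<bar> * (min x t - L))"
  proof (rule Bochner_Integration.integrable_bound)
    show "integrable \<mu> (\<lambda>x. \<bar>k x\<bar> * (t - L))"
      using k by simp
    show "AE x in \<mu>. norm (\<bar>k x\<bar> * (min x t - L)) \<le> norm (\<bar>k x\<bar> * (t - L))"
      using supp by eventually_elim (use \<open>L < t\<close> in \<open>auto simp: abs_mult intro!: mult_left_mono\<close>)
  qed simp
  moreover have "AE x in \<mu>. (LINT s|lborel. norm (?f x s)) = \<bar>k x\<bar> * (min x t - L)"
    using supp by eventually_elim (rule inner_abs)
  ultimately have "integrable \<mu> (\<lambda>x. LINT s|lborel. norm (?f x s))"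
    by (subst integrable_cong_AE[where g = "\<lambda>x. \<bar>k x\<bar> * (min x t - L)"]) auto
  moreover have "AE x in \<mu>. integrable lborel (?f x)"
    using supp by eventually_elim (rule inner_int)
  ultimately have int: "integrable (\<mu> \<Otimes>\<^sub>M lborel) (case_prod ?f)"
    by (intro Fubini_integrable meas) simp_all
  show "set_integrable lborel {L<..t} (\<lambda>s. LINT x:{s<..}|\<mu>. k x)"
    using integrable_snd[OF int] by (simp add: set_integrable_def set_lebesgue_integral_def)
  have "(LINT s:{L<..t}|lborel. LINT x:{s<..}|\<mu>. k x) = (LINT s|lborel. LINT x|\<mu>. ?f x s)"
    by (simp add: set_lebesgue_integral_def)
  also have "\<dots> = (LINT x|\<mu>. LINT s|lborel. ?f x s)"
    by (rule Fubini_integral[OF int])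
  also have "\<dots> = (LINT x|\<mu>. k x * (min x t - L))"
    using supp by (intro integral_cong_AE) (auto elim!: eventually_mono simp: inner)
  finally show "(LINT s:{L<..t}|lborel. LINT x:{s<..}|\<mu>. k x) = (LINT x|\<mu>. k x * (min x t - L))" .
qed

text \<open>
  Up to a constant the tail integral is minus an indefinite gauge integral, so its continuity
  and its derivative are those of indefinite integrals.
\<close>

lemma tail_integral_shift:
  fixes f :: "real \<Rightarrow> real"
  assumes f: "integrable lborel f" and "a \<le> s"
  shows "(LINT x:{s<..}|lborel. f x) = (LINT x:{a<..}|lborel. f x) - integral {a..s} f"
proof -
  have si: "set_integrable lborel A f" if "A \<in> sets borel" for A
    using f that by (intro integrable_mult_indicator[folded set_integrable_def]) (auto)
  have [measurable]: "f \<in> borel_measurable borel"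
    using borel_measurable_integrable[OF f] by simp
  have "{a<..} = {a<..s} \<union> {s<..}" using \<open>a \<le> s\<close> by auto
  then have "(LINT x:{a<..}|lborel. f x) = (LINT x:{a<..s} \<union> {s<..}|lborel. f x)"
    by (rule arg_cong)
  also have "\<dots> = (LINT x:{a<..s}|lborel. f x) + (LINT x:{s<..}|lborel. f x)"
    by (rule set_integral_Un) (auto intro: si)
  also have "(LINT x:{a<..s}|lborel. f x) = (LINT x:{a..s}|lborel. f x)"
    using AE_lborel_singleton[of a]
    by (intro set_integral_cong_set)
       (auto simp: set_borel_measurable_def elim!: eventually_mono)
  also have "\<dots> = integral {a..s} f"
    by (rule set_borel_integral_eq_integral(2)) (simp add: si)
  finally show ?thesis by simp
qed

lemma tail_integral_continuous:
  fixes f :: "real \<Rightarrow> real"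
  assumes f: "integrable lborel f"
  shows "continuous_on UNIV (\<lambda>s. LINT x:{s<..}|lborel. f x)"
proof (rule continuous_at_imp_continuous_on, safe)
  fix s :: real
  have io: "f integrable_on {s-1..s+1}"
    by (rule set_borel_integral_eq_integral(1))
       (auto intro!: integrable_mult_indicator[folded set_integrable_def] f)
  have "continuous_on {s-1..s+1} (\<lambda>u. (LINT x:{s-1<..}|lborel. f x) - integral {s-1..u} f)"
    by (intro continuous_intros indefinite_integral_continuous_1 io)
  then have cont: "continuous_on {s-1..s+1} (\<lambda>u. LINT x:{u<..}|lborel. f x)"
    by (rule continuous_on_eq) (simp add: tail_integral_shift[OF f, symmetric])
  show "isCont (\<lambda>s. LINT x:{s<..}|lborel. f x) s"
    by (rule continuous_on_interior[OF cont]) simp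
qed

lemma tail_integral_has_derivative:
  fixes f :: "real \<Rightarrow> real"
  assumes f: "integrable lborel f" and "isCont f s"
  shows "((\<lambda>s. LINT x:{s<..}|lborel. f x) has_real_derivative - f s) (at s)"
proof -
  have io: "f integrable_on {s-1..s+1}"
    by (rule set_borel_integral_eq_integral(1))
       (auto intro!: integrable_mult_indicator[folded set_integrable_def] f)
  have at: "at s within {s-1..s+1} = at s"
    by (rule at_within_interior) (auto simp: interior_atLeastAtMost_real)
  have "((\<lambda>u. integral {s-1..u} f) has_vector_derivative f s) (at s within {s-1..s+1})"
    using integral_has_vector_derivative_continuous_at[OF io, of s "{}"] \<open>isCont f s\<close>
    by (simp add: continuous_at_imp_continuous_at_within)
  then have "((\<lambda>u. integral {s-1..u} f) has_real_derivative f s) (at s)"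
    by (simp add: at has_real_derivative_iff_has_vector_derivative)
  then have deriv: "((\<lambda>u. (LINT x:{s-1<..}|lborel. f x) - integral {s-1..u} f)
      has_real_derivative - f s) (at s)"
    by (auto intro!: derivative_eq_intros)
  have ev: "\<forall>\<^sub>F u in nhds s. (LINT x:{u<..}|lborel. f x) =
      (LINT x:{s-1<..}|lborel. f x) - integral {s-1..u} f"
  proof -
    have "\<forall>\<^sub>F u in nhds s. s - 1 < u"
      by (rule order_tendstoD(1)[OF filterlim_ident]) simp
    then show ?thesis
      by eventually_elim (simp add: tail_integral_shift[OF f, symmetric])
  qed
  show ?thesis
    by (rule iffD2[OF DERIV_cong_ev[OF refl ev refl] deriv])
qed

lemma tail_integral_vanishes_at_top:
  fixes f :: "real \<Rightarrow> real"
  assumes f: "integrable lborel f"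
  shows "((\<lambda>s. LINT x:{s<..}|lborel. f x) \<longlongrightarrow> 0) at_top"
proof -
  have "((\<lambda>s. LINT x|lborel. indicator {s<..} x *\<^sub>R f x) \<longlongrightarrow> (LINT x::real|lborel. 0)) at_top"
  proof (rule integral_dominated_convergence_at_top[where w = "\<lambda>x. norm (f x)"])
    show "AE x in lborel. ((\<lambda>s. indicator {s<..} x *\<^sub>R f x) \<longlongrightarrow> 0) at_top"
    proof (rule AE_I2)
      fix x :: real
      show "((\<lambda>s. indicator {s<..} x *\<^sub>R f x) \<longlongrightarrow> 0) at_top"
        by (rule tendsto_eventually, rule eventually_mono[OF eventually_ge_at_top[of x]]) auto
    qed
  qed (use borel_measurable_integrable[OF f] f in \<open>simp_all add: indicator_def\<close>)
  then show ?thesis by (simp add: set_lebesgue_integral_def)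
qed

text \<open>
  For a measure with atoms, the tail integral need not be left-continuous. From the right,
  the indicators of \<open>{s<..}\<close> converge pointwise to that of \<open>{a<..}\<close>, and dominated convergence
  applies.
\<close>

lemma tail_integral_right_continuous:
  fixes k :: "real \<Rightarrow> real"
  assumes k: "integrable \<mu> k" and [measurable_cong]: "sets \<mu> = sets borel"
  shows "((\<lambda>s. LINT x:{s<..}|\<mu>. k x) \<longlongrightarrow> (LINT x:{a<..}|\<mu>. k x)) (at_right a)"
proof (rule tendsto_at_right_sequentially[of a "a + 1"])
  fix S :: "nat \<Rightarrow> real"
  assume S: "\<And>n. a < S n" "S \<longlonglongrightarrow> a"
  have [measurable]: "k \<in> borel_measurable borel"
    using borel_measurable_integrable[OF k] by measurable
  show "(\<lambda>n. LINT x:{S n<..}|\<mu>. k x) \<longlonglongrightarrow> (LINT x:{a<..}|\<mu>. k x)"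
    unfolding set_lebesgue_integral_def
  proof (rule integral_dominated_convergence[where w = "\<lambda>x. norm (k x)"])
    show "AE x in \<mu>. (\<lambda>n. indicator {S n<..} x *\<^sub>R k x) \<longlonglongrightarrow> indicator {a<..} x *\<^sub>R k x"
    proof (rule AE_I2)
      fix x
      have "\<forall>\<^sub>F n in sequentially. indicator {S n<..} x *\<^sub>R k x = indicator {a<..} x *\<^sub>R k x"
      proof (cases "a < x")
        case True
        from order_tendstoD(2)[OF S(2) this] show ?thesis
          by eventually_elim (use True in simp)
      next
        case False
        then have "\<not> S n < x" for n using S(1)[of n] by simp
        with False show ?thesis by simp
      qed
      then show "(\<lambda>n. indicator {S n<..} x *\<^sub>R k x) \<longlonglongrightarrow> indicator {a<..} x *\<^sub>R k x"
        by (rule tendsto_eventually)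
    qed
  qed (use k in \<open>auto simp: indicator_def\<close>)
qed simp

section \<open>Facts from real analysis\<close>

lemma integrable_limit_at_top_zero:
  fixes p :: "real \<Rightarrow> real"
  assumes p: "integrable lborel p" "\<And>x. 0 \<le> p x" and lim: "(p \<longlongrightarrow> c) at_top"
  shows "c = 0"
proof (rule ccontr)
  assume "c \<noteq> 0"
  moreover have "0 \<le> c"
    using tendsto_lowerbound[OF lim] p(2) by auto
  ultimately have "c / 2 < c" by simp
  then obtain N where N: "\<And>x. N \<le> x \<Longrightarrow> c / 2 < p x"
    using order_tendstoD(1)[OF lim] unfolding eventually_at_top_linorder by blast
  define I where "I = (LINT x|lborel. p x)"
  have bd: "c / 2 * r \<le> I" if "0 \<le> r" for r
  proof -
    have "c / 2 * r = (LINT x|lborel. c / 2 * indicator {N..N+r} x)"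
      using that by simp
    also have "\<dots> \<le> I"
      unfolding I_def
    proof (rule integral_mono[OF _ p(1)])
      show "integrable lborel (\<lambda>x. c / 2 * indicator {N..N+r} x)"
        using that by (intro integrable_mult_right integrable_real_indicator) auto
      show "c / 2 * indicator {N..N+r} x \<le> p x" for x
        using N[of x] p(2)[of x] by (auto simp: indicator_def)
    qed
    finally show ?thesis .
  qed
  have "0 < c" using \<open>c \<noteq> 0\<close> \<open>0 \<le> c\<close> by simp
  have "0 \<le> I" unfolding I_def by (simp add: p(2))
  \<comment> \<open>an interval so long that the lower bound on it exceeds the total integral by \<open>1\<close>\<close>
  have "c / 2 * ((I + 1) * 2 / c) \<le> I"
    using \<open>0 < c\<close> \<open>0 \<le> I\<close> by (intro bd) auto
  then show False using \<open>0 < c\<close> by simp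
qed

lemma constant_off_finite_set:
  fixes f :: "real \<Rightarrow> real"
  assumes "continuous_on {L<..} f" "finite K"
    and "\<And>x. x \<in> {L<..} - K \<Longrightarrow> (f has_real_derivative 0) (at x)"
  obtains c where "\<And>x. L < x \<Longrightarrow> f x = c"
proof
  fix x assume "L < x"
  show "f x = f (L + 1)"
  proof (rule has_derivative_zero_unique_strong_convex[of "{L<..}" K f "L + 1"])
    show "(f has_derivative (\<lambda>h. 0)) (at z within {L<..})" if "z \<in> {L<..} - K" for z
      using assms(3)[OF that]
      by (simp add: has_field_derivative_def has_derivative_at_withinI lambda_zero)
  qed (use assms \<open>L < x\<close> in auto)
qed

text \<open>
  A right-continuous function that is negative at \<open>a\<close> stays below \<open>q a / 2\<close> on some interval
  to the right of \<open>a\<close>, so its integral over that interval would be negative.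
\<close>

lemma nonneg_of_interval_integrals_nonneg:
  fixes q :: "real \<Rightarrow> real"
  assumes "set_integrable lborel {a<..b} q" "a < b"
    and lim: "(q \<longlongrightarrow> q a) (at_right a)"
    and nn: "\<And>c. a < c \<Longrightarrow> c \<le> b \<Longrightarrow> 0 \<le> (LINT s:{a<..c}|lborel. q s)"
  shows "0 \<le> q a"
proof (rule ccontr)
  assume "\<not> 0 \<le> q a"
  then have "q a < q a / 2" "q a < 0" by auto
  from order_tendstoD(2)[OF lim this(1)] obtain d where d: "d > a" "\<And>x. a < x \<Longrightarrow> x < d \<Longrightarrow> q x < q a / 2"
    unfolding eventually_at_right_field by blast
  define c where "c = min b ((a + d) / 2)"
  have c: "a < c" "c \<le> b" "c < d" using d(1) \<open>a < b\<close> by (auto simp: c_def min_def)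
  have "(LINT s:{a<..c}|lborel. q s) \<le> (LINT s:{a<..c}|lborel. q a / 2)"
  proof (rule set_integral_mono)
    show "set_integrable lborel {a<..c} q"
      by (rule set_integrable_subset[OF assms(1)]) (use c in auto)
    show "set_integrable lborel {a<..c} (\<lambda>s. q a / 2)"
      unfolding set_integrable_def real_scaleR_def
      using c by (intro integrable_mult_left integrable_real_indicator) auto
    show "q s \<le> q a / 2" if "s \<in> {a<..c}" for s
      using d(2)[of s] that c by auto
  qed
  also have "\<dots> = (c - a) * (q a / 2)"
    using c by (simp add: set_lebesgue_integral_def)
  also have "\<dots> < 0" using c \<open>q a < 0\<close> by (simp add: mult_pos_neg)
  finally show False using nn[OF c(1,2)] by simp
qed

section \<open>Recognizing a density from the distribution function\<close>

text \<open>
  Monotonicity of the distribution function makes the integrals of \<open>q\<close> over all intervals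
  nonnegative, which right-continuity turns into \<open>q \<ge> 0\<close> at every point. Thus \<open>q\<close>, cut off at
  \<open>L\<close>, is the density of a measure. That measure has the same distribution function as \<open>\<mu>\<close>;
  letting the argument tend to infinity shows that its total mass is \<open>1\<close>, so that the
  distribution function determines it.
\<close>

lemma real_distribution_eq_density:
  fixes q :: "real \<Rightarrow> real"
  assumes "real_distribution \<mu>" and null: "measure \<mu> {..L} = 0"
    and int: "\<And>t. L < t \<Longrightarrow> set_integrable lborel {L<..t} q"
    and rc: "\<And>a. L < a \<Longrightarrow> (q \<longlongrightarrow> q a) (at_right a)"
    and cdf: "\<And>t. L < t \<Longrightarrow> cdf \<mu> t = (LINT s:{L<..t}|lborel. q s)"
  shows "\<And>a. L < a \<Longrightarrow> 0 \<le> q a"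
    and "(\<lambda>x. indicator {L<..} x * q x) \<in> borel_measurable borel"
    and "\<mu> = density lborel (\<lambda>x. ennreal (indicator {L<..} x * q x))"
proof -
  interpret real_distribution \<mu> by fact
  show nn: "0 \<le> q a" if "L < a" for a
  proof (rule nonneg_of_interval_integrals_nonneg[of a "a + 1"])
    show "set_integrable lborel {a<..a+1} q"
      by (rule set_integrable_subset[OF int[of "a + 1"]]) (use that in auto)
    show "0 \<le> (LINT s:{a<..c}|lborel. q s)" if "a < c" "c \<le> a + 1" for c
    proof -
      have "(LINT s:{L<..c}|lborel. q s) = (LINT s:{L<..a} \<union> {a<..c}|lborel. q s)"
        using \<open>L < a\<close> \<open>a < c\<close> by (intro arg_cong2[where f = "\<lambda>A. set_lebesgue_integral lborel A"]) auto
      also have "\<dots> = (LINT s:{L<..a}|lborel. q s) + (LINT s:{a<..c}|lborel. q s)"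
        by (intro set_integral_Un int \<open>L < a\<close> set_integrable_subset[OF int[of c]])
           (use \<open>L < a\<close> \<open>a < c\<close> in auto)
      finally have "(LINT s:{a<..c}|lborel. q s) = cdf \<mu> c - cdf \<mu> a"
        using \<open>L < a\<close> \<open>a < c\<close> by (simp add: cdf)
      then show ?thesis using cdf_nondecreasing[of a c] \<open>a < c\<close> by simp
    qed
  qed (use rc that in auto)
  let ?q = "\<lambda>x. indicator {L<..} x * q x"
  \<comment> \<open>integrability is known on bounded intervals only, so measurability is obtained as a limit\<close>
  show meas [measurable]: "?q \<in> borel_measurable borel"
  proof (rule borel_measurable_LIMSEQ_real)
    fix x :: real
    show "(\<lambda>n. indicator {L<..L + real (Suc n)} x * q x) \<longlonglongrightarrow> ?q x"
    proof (rule tendsto_eventually)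
      obtain N :: nat where N: "x - L \<le> real N" using real_arch_simple by blast
      show "\<forall>\<^sub>F n in sequentially. indicator {L<..L + real (Suc n)} x * q x = ?q x"
        using eventually_ge_at_top[of N]
        by eventually_elim (use N in \<open>auto simp: indicator_def\<close>)
    qed
  next
    fix n
    show "(\<lambda>x. indicator {L<..L + real (Suc n)} x * q x) \<in> borel_measurable borel"
      using borel_measurable_integrable[OF int[of "L + real (Suc n)", unfolded set_integrable_def]] by simp
  qed
  define D where "D = density lborel (\<lambda>x. ennreal (?q x))"
  have D_sets [simp, measurable_cong]: "sets D = sets borel" by (simp add: D_def)
  have D_emeasure: "emeasure D A = (\<integral>\<^sup>+x. ennreal (?q x) * indicator A x \<partial>lborel)"
    if "A \<in> sets borel" for A
    unfolding D_def using that by (intro emeasure_density) simp_all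
  have space_eq: "space D = UNIV" by (simp add: D_def)
  have D_cdf: "emeasure D {..t} = ennreal (cdf \<mu> t)" for t
  proof (cases "L < t")
    case True
    have "emeasure D {..t} = (\<integral>\<^sup>+x. ennreal (indicator {L<..t} x *\<^sub>R q x) \<partial>lborel)"
      by (subst D_emeasure) (auto intro!: nn_integral_cong simp: indicator_def)
    also have "\<dots> = ennreal (LINT s:{L<..t}|lborel. q s)"
      unfolding set_lebesgue_integral_def
      by (intro nn_integral_eq_integral int[OF True, unfolded set_integrable_def])
         (auto simp: indicator_def nn)
    finally show ?thesis using cdf[OF True] by simp
  next
    case False
    have "emeasure D {..t} = (\<integral>\<^sup>+x. 0 \<partial>(lborel :: real measure))"
      by (subst D_emeasure, simp, intro nn_integral_cong) (use False in \<open>auto simp: indicator_def\<close>)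
    moreover have "cdf \<mu> t = 0"
      using finite_measure_mono[of "{..t}" "{..L}"] False null
      by (auto simp: cdf_def intro!: antisym)
    ultimately show ?thesis by simp
  qed
  have "(\<lambda>n::nat. emeasure D {..real n}) \<longlonglongrightarrow> emeasure D (\<Union>n::nat. {..real n})"
    by (rule Lim_emeasure_incseq) (auto simp: incseq_def)
  moreover have "(\<Union>n::nat. {..real n}) = UNIV" by (auto intro: real_arch_simple)
  moreover have "(\<lambda>n::nat. emeasure D {..real n}) \<longlonglongrightarrow> ennreal 1"
    unfolding D_cdf
    by (intro tendsto_ennrealI filterlim_compose[OF cdf_lim_at_top_prob filterlim_real_sequentially])
  ultimately have "emeasure D UNIV = 1"
    by (metis LIMSEQ_unique ennreal_1)
  then have "real_distribution D"
    by (intro real_distribution.intro prob_spaceI real_distribution_axioms.intro D_sets)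
       (simp add: space_eq)
  moreover have "cdf \<mu> = cdf D"
    by (rule ext) (simp add: cdf_def2[of D] measure_def D_cdf cdf_nonneg)
  ultimately show "\<mu> = density lborel (\<lambda>x. ennreal (?q x))"
    unfolding D_def[symmetric] by (intro cdf_unique real_distribution_axioms)
qed


section \<open>Densities that are piecewise continuously differentiable\<close>

text \<open>
  The value \<open>p L\<close> is left free: a single point is irrelevant for a density, and all pointwise
  arguments take place in \<open>{L<..}\<close>.
\<close>

locale piecewise_C1_density =
  fixes p :: "real \<Rightarrow> real" and L :: real and K :: "real set"
  assumes finite_exceptions: "finite K"
    and measurable_p [measurable]: "p \<in> borel_measurable borel"
    and nonneg: "0 \<le> p x"
    and total_mass: "(\<integral>\<^sup>+x. ennreal (p x) \<partial>lborel) = 1"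
    and zero_left: "x < L \<Longrightarrow> p x = 0"
    and cont: "continuous_on {L<..} p"
    and pos: "L < x \<Longrightarrow> 0 < p x"
    and deriv: "x \<in> {L<..} - K \<Longrightarrow> (p has_real_derivative deriv p x) (at x)"
    and deriv_cont: "continuous_on ({L<..} - K) (deriv p)"
begin

text \<open>
  The indicator replaces the arbitrary values of \<open>deriv p\<close> at the exceptional points and to the
  left of \<open>L\<close> by zero, which makes the function Borel measurable.
\<close>

definition neg_score :: "real \<Rightarrow> real" where
  "neg_score x = - (indicator ({L<..} - K) x * (deriv p x / p x))"

lemma neg_score_measurable [measurable]: "neg_score \<in> borel_measurable borel"
proof -
  have "open ({L<..} - K)"
    using finite_exceptions by (intro open_Diff finite_imp_closed) auto
  then have [measurable]: "(\<lambda>x. indicator ({L<..} - K) x *\<^sub>R deriv p x) \<in> borel_measurable borel"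
    by (intro borel_measurable_continuous_on_indicator deriv_cont) auto
  have "(\<lambda>x. - (indicator ({L<..} - K) x *\<^sub>R deriv p x) / p x) \<in> borel_measurable borel"
    by measurable
  then show ?thesis by (simp add: neg_score_def[abs_def])
qed

lemma integrable_p: "integrable lborel p"
  by (rule integrableI_nonneg) (simp_all add: nonneg total_mass)

lemma tail_integral_density:
  assumes "w \<in> borel_measurable borel" "\<And>x. 0 \<le> w x"
  shows "(LINT x:{s<..}|density lborel (\<lambda>x. ennreal (w x)). neg_score x) =
      (LINT x:{s<..}|lborel. w x * neg_score x)"
  using assms unfolding set_lebesgue_integral_def
  by (subst integral_density) (auto simp: mult_ac)

lemma isCont_mult_neg_score:
  assumes w: "continuous_on {L<..} w" and x: "x \<in> {L<..} - K"
  shows "isCont (\<lambda>x. w x * neg_score x) x"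
proof -
  have op: "open ({L<..} - K)"
    using finite_exceptions by (intro open_Diff finite_imp_closed) auto
  have "continuous_on ({L<..} - K) (\<lambda>x. w x * - (deriv p x / p x))"
    using pos by (intro continuous_intros deriv_cont continuous_on_subset[OF w]
        continuous_on_subset[OF cont]) (auto simp: less_imp_neq[symmetric])
  then have "continuous_on ({L<..} - K) (\<lambda>x. w x * neg_score x)"
    by (rule continuous_on_eq) (simp add: neg_score_def)
  with op x show ?thesis by (simp add: continuous_on_eq_continuous_at)
qed

text \<open>
  Both sides have derivative \<open>deriv p\<close> off the exceptional points, so they differ by a constant
  \<open>c\<close>. The tail integral vanishes at infinity, hence \<open>p\<close> tends to \<open>c\<close>, and \<open>c = 0\<close> since \<open>p\<close>
  is integrable.
\<close>

lemma tail_integral_neg_score: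
  assumes int: "integrable (density lborel (\<lambda>x. ennreal (p x))) neg_score" and "L < s"
  shows "(LINT x:{s<..}|density lborel (\<lambda>x. ennreal (p x)). neg_score x) = p s"
proof -
  define T where "T s = (LINT x:{s<..}|lborel. p x * neg_score x)" for s
  have f: "integrable lborel (\<lambda>x. p x * neg_score x)"
    using int by (subst (asm) integrable_density) (auto simp: nonneg)
  have T_deriv: "(T has_real_derivative deriv p x) (at x)" if x: "x \<in> {L<..} - K" for x
  proof -
    have "(T has_real_derivative - (p x * neg_score x)) (at x)"
      unfolding T_def by (intro tail_integral_has_derivative f isCont_mult_neg_score cont x)
    moreover have "- (p x * neg_score x) = deriv p x"
      using x pos[of x] by (simp add: neg_score_def)
    ultimately show ?thesis by simp
  qed
  have T_cont: "continuous_on {L<..} T"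
    unfolding T_def by (rule continuous_on_subset[OF tail_integral_continuous[OF f]]) simp
  obtain c where c: "\<And>x. L < x \<Longrightarrow> p x - T x = c"
  proof (rule constant_off_finite_set)
    show "continuous_on {L<..} (\<lambda>x. p x - T x)"
      by (intro continuous_intros cont T_cont)
    show "((\<lambda>x. p x - T x) has_real_derivative 0) (at x)" if "x \<in> {L<..} - K" for x
      using DERIV_diff[OF deriv[OF that] T_deriv[OF that]] by simp
  qed (use finite_exceptions in auto)
  have "((\<lambda>x. c + T x) \<longlongrightarrow> c + 0) at_top"
    unfolding T_def by (intro tendsto_intros tail_integral_vanishes_at_top f)
  moreover have "\<forall>\<^sub>F x in at_top. c + T x = p x"
    using eventually_gt_at_top[of L] by eventually_elim (simp add: c[symmetric])
  ultimately have "(p \<longlongrightarrow> c) at_top"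
    using tendsto_cong by fastforce
  then have "c = 0"
    by (rule integrable_limit_at_top_zero[OF integrable_p nonneg])
  then show ?thesis
    using c[OF \<open>L < s\<close>] by (simp add: tail_integral_density nonneg T_def)
qed

text \<open>
  The fixed point equation bootstraps regularity: the right-hand side is an integral with
  respect to Lebesgue measure, so \<open>q\<close> is continuous; then the integrand is continuous off the
  exceptional points, so \<open>q\<close> is differentiable there and satisfies the linear equation
  \<open>q' = q p' / p\<close>. By the quotient rule \<open>q / p\<close> has derivative zero.
\<close>

lemma tail_fixed_point_proportional:
  fixes q :: "real \<Rightarrow> real"
  defines "w \<equiv> \<lambda>x. indicator {L<..} x * q x"
  assumes [measurable]: "w \<in> borel_measurable borel" and nn: "\<And>x. L < x \<Longrightarrow> 0 \<le> q x"
    and int: "integrable (density lborel (\<lambda>x. ennreal (w x))) neg_score"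
    and fixed: "\<And>s. L < s \<Longrightarrow> q s = (LINT x:{s<..}|density lborel (\<lambda>x. ennreal (w x)). neg_score x)"
  obtains c where "\<And>x. L < x \<Longrightarrow> q x = c * p x"
proof -
  have w_nn: "0 \<le> w x" for x by (simp add: w_def indicator_def nn)
  define T where "T s = (LINT x:{s<..}|lborel. w x * neg_score x)" for s
  have f: "integrable lborel (\<lambda>x. w x * neg_score x)"
    using int by (subst (asm) integrable_density) (auto simp: w_nn)
  have qT: "q s = T s" if "L < s" for s
    using fixed[OF that] by (simp add: tail_integral_density w_nn T_def)
  have wT: "w s = T s" if "L < s" for s
    using that by (simp add: w_def qT)
  have T_cont: "continuous_on {L<..} T"
    unfolding T_def by (rule continuous_on_subset[OF tail_integral_continuous[OF f]]) simp
  then have w_cont: "continuous_on {L<..} w"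
    by (rule continuous_on_eq) (simp add: wT)
  have T_deriv: "(T has_real_derivative T x * deriv p x / p x) (at x)" if x: "x \<in> {L<..} - K" for x
  proof -
    have "(T has_real_derivative - (w x * neg_score x)) (at x)"
      unfolding T_def by (intro tail_integral_has_derivative f isCont_mult_neg_score w_cont x)
    then show ?thesis using x by (simp add: neg_score_def wT)
  qed
  obtain c where c: "\<And>x. L < x \<Longrightarrow> T x / p x = c"
  proof (rule constant_off_finite_set)
    show "continuous_on {L<..} (\<lambda>x. T x / p x)"
      using pos by (intro continuous_intros cont T_cont) (auto simp: less_imp_neq[symmetric])
    show "((\<lambda>x. T x / p x) has_real_derivative 0) (at x)" if x: "x \<in> {L<..} - K" for x
      using DERIV_divide[OF T_deriv[OF x] deriv[OF x]] x pos[of x] by simp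
  qed (use finite_exceptions in auto)
  show ?thesis
  proof (rule that)
    show "q x = c * p x" if "L < x" for x
      using c[OF that] pos[OF that] qT[OF that] by (simp add: field_simps)
  qed
qed

text \<open>
  By \<open>tail_integral_mixture\<close> the right-hand side says that the tail integral \<open>q\<close> integrates to
  the distribution function; the two implications are then the two lemmas on tail integrals
  above.
\<close>

theorem density_iff_cdf_eq:
  assumes "real_distribution \<mu>" and supp: "AE x in \<mu>. L < x"
    and int: "integrable \<mu> neg_score"
  shows "\<mu> = density lborel (\<lambda>x. ennreal (p x)) \<longleftrightarrow>
    (\<forall>t>L. cdf \<mu> t = (LINT x|\<mu>. neg_score x * (min x t - L)))"
proof -
  interpret real_distribution \<mu> by fact
  define q where "q s = (LINT x:{s<..}|\<mu>. neg_score x)" for s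
  have q_int: "set_integrable lborel {L<..t} q"
    and q_cdf: "(LINT s:{L<..t}|lborel. q s) = (LINT x|\<mu>. neg_score x * (min x t - L))" if "L < t" for t
    using tail_integral_mixture[OF prob_space_axioms _ int supp that] by (simp_all add: q_def[abs_def])
  have "\<mu> = density lborel (\<lambda>x. ennreal (p x)) \<longleftrightarrow> (\<forall>t>L. cdf \<mu> t = (LINT s:{L<..t}|lborel. q s))"
  proof (intro iffI allI impI)
    fix t assume \<mu>: "\<mu> = density lborel (\<lambda>x. ennreal (p x))" and "L < t"
    have "q s = p s" if "L < s" for s
      using tail_integral_neg_score[OF _ that] int unfolding q_def \<mu> by simp
    then have q_p: "(LINT s:{L<..t}|lborel. q s) = (LINT s:{L<..t}|lborel. p s)"
      by (intro set_lebesgue_integral_cong) auto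
    have p_t: "integrable lborel (\<lambda>x. indicator {L<..t} x *\<^sub>R p x)"
      by (intro integrable_mult_indicator integrable_p) simp
    have "emeasure \<mu> {..t} = (\<integral>\<^sup>+x. ennreal (p x) * indicator {..t} x \<partial>lborel)"
      unfolding \<mu> by (rule emeasure_density) simp_all
    also have "\<dots> = (\<integral>\<^sup>+x. ennreal (indicator {L<..t} x *\<^sub>R p x) \<partial>lborel)"
    proof (rule nn_integral_cong_AE)
      show "AE x in lborel. ennreal (p x) * indicator {..t} x = ennreal (indicator {L<..t} x *\<^sub>R p x)"
        using AE_lborel_singleton[of L]
      proof eventually_elim
        fix x assume "x \<noteq> L"
        then show "ennreal (p x) * indicator {..t} x = ennreal (indicator {L<..t} x *\<^sub>R p x)"
          using zero_left[of x] by (cases "x < L") (auto simp: indicator_def)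
      qed
    qed
    also have "\<dots> = ennreal (LINT s:{L<..t}|lborel. p s)"
      unfolding set_lebesgue_integral_def
      by (intro nn_integral_eq_integral p_t) (simp add: nonneg)
    finally have "cdf \<mu> t = (LINT s:{L<..t}|lborel. p s)"
      unfolding cdf_def measure_def set_lebesgue_integral_def by (simp add: nonneg)
    with q_p show "cdf \<mu> t = (LINT s:{L<..t}|lborel. q s)" by simp
  next
    assume cdf: "\<forall>t>L. cdf \<mu> t = (LINT s:{L<..t}|lborel. q s)"
    define w where "w x = indicator {L<..} x * q x" for x
    have null: "measure \<mu> {..L} = 0"
      using supp by (subst measure_eq_0_null_sets) (auto simp: null_sets_def AE_iff_measurable[OF _ refl] not_less atMost_def)
    have rc: "(q \<longlongrightarrow> q a) (at_right a)" for a
      unfolding q_def by (rule tail_integral_right_continuous[OF int]) simp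
    note dens = real_distribution_eq_density[OF real_distribution_axioms null q_int rc, folded w_def]
    have q_nn: "0 \<le> q a" if "L < a" for a
      by (rule dens(1)) (use that cdf in auto)
    have w_meas [measurable]: "w \<in> borel_measurable borel"
      using dens(2) cdf unfolding w_def[abs_def] by blast
    have \<mu>_w: "\<mu> = density lborel (\<lambda>x. ennreal (w x))"
      using dens(3) cdf by blast
    obtain c where c: "\<And>x. L < x \<Longrightarrow> q x = c * p x"
      by (rule tail_fixed_point_proportional[of q, folded w_def])
         (use q_nn int w_meas in \<open>auto simp: q_def \<mu>_w[symmetric] simp flip: w_def\<close>)
    \<comment> \<open>both densities have mass \<open>1\<close>, which forces \<open>c = 1\<close>\<close>
    have "0 \<le> c * p (L + 1)" using q_nn[of "L + 1"] c[of "L + 1"] by simp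
    then have "0 \<le> c" using pos[of "L + 1"] by (simp add: zero_le_mult_iff)
    have w_cp: "AE x in lborel. ennreal (w x) = ennreal c * ennreal (p x)"
      using AE_lborel_singleton[of L]
    proof eventually_elim
      fix x assume "x \<noteq> L"
      then show "ennreal (w x) = ennreal c * ennreal (p x)"
        using zero_left[of x] c[of x] \<open>0 \<le> c\<close>
        by (cases "x < L") (auto simp: w_def ennreal_mult nonneg)
    qed
    have "1 = emeasure \<mu> UNIV" using emeasure_space_1 by simp
    also have "\<dots> = (\<integral>\<^sup>+x. ennreal (w x) \<partial>lborel)"
      by (subst \<mu>_w, subst emeasure_density) simp_all
    also have "\<dots> = (\<integral>\<^sup>+x. ennreal c * ennreal (p x) \<partial>lborel)"
      by (rule nn_integral_cong_AE[OF w_cp])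
    also have "\<dots> = ennreal c"
      by (simp add: nn_integral_cmult total_mass)
    finally have "c = 1" using \<open>0 \<le> c\<close> by simp
    then show "\<mu> = density lborel (\<lambda>x. ennreal (p x))"
      using w_cp by (subst \<mu>_w) (intro density_cong, auto)
  qed
  then show ?thesis using q_cdf by auto
qed

end

text \<open>
  Components of an open set of reals are open, so differentiability and continuity of the
  derivative on each of them are local statements that hold on the whole set.
\<close>

lemma C1_on_components_deriv:
  fixes p :: "real \<Rightarrow> real"
  assumes "open S" and C1: "\<And>I. I \<in> components S \<Longrightarrow> p C1_differentiable_on I"
  shows "\<And>x. x \<in> S \<Longrightarrow> (p has_real_derivative deriv p x) (at x)"
    and "continuous_on S (deriv p)"
proof -
  have *: "(p has_real_derivative deriv p x) (at x) \<and> isCont (deriv p) x" if "x \<in> S" for x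
  proof -
    from that obtain I where I: "I \<in> components S" "x \<in> I"
      by (metis UnionE Union_components)
    have "open I" using open_components[OF \<open>open S\<close> I(1)] .
    from C1[OF I(1)] obtain D where D: "\<And>z. z \<in> I \<Longrightarrow> (p has_real_derivative D z) (at z)"
      and "continuous_on I D"
      unfolding C1_differentiable_on_def has_real_derivative_iff_has_vector_derivative by blast
    have "D z = deriv p z" if "z \<in> I" for z
      using DERIV_imp_deriv[OF D[OF that]] by simp
    with \<open>continuous_on I D\<close> have "continuous_on I (deriv p)"
      by (rule continuous_on_eq)
    with \<open>open I\<close> I(2) D[OF I(2)] DERIV_imp_deriv[OF D[OF I(2)]] show ?thesis
      by (auto simp: continuous_on_eq_continuous_at)
  qed
  then show "\<And>x. x \<in> S \<Longrightarrow> (p has_real_derivative deriv p x) (at x)"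
    and "continuous_on S (deriv p)"
    by (auto intro: continuous_at_imp_continuous_on)
qed

section \<open>The characterization\<close>

theorem theorem5p4:
  fixes M :: "'a measure" and X :: "'a \<Rightarrow> real"
    and p :: "real \<Rightarrow> real" and L :: real and m :: nat and y :: "nat \<Rightarrow> real"
  defines "S \<equiv> smooth_set L m y" and "P \<equiv> dist_fun L p"
  assumes pdf: "pdf_with_support p {L..}"
    and i_cont: "continuous_on {L<..} p"
    and i_pos: "\<forall>x>L. 0 < p x"
    and i_points: "\<forall>i\<in>{1..m}. L < y i" "strict_mono_on {1..m} y"
    and i_C1: "\<forall>I\<in>components S. p C1_differentiable_on I"
    and ii: "bdd_above ((\<lambda>x. \<bar>deriv p x * min (P x) (1 - P x) / (p x)\<^sup>2\<bar>) ` S)"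
    and iii: "set_integrable lborel S (\<lambda>x. (1 + \<bar>x\<bar>) * \<bar>deriv p x\<bar>)"
    and iv: "((\<lambda>x. P x / p x) \<longlongrightarrow> 0) (at_right L)"
    and M: "prob_space M"
    and X_rv: "X \<in> borel_measurable M"
    and X_gt: "\<forall>\<omega>\<in>space M. L < X \<omega>"
    and X_S: "measure M {\<omega>\<in>space M. X \<omega> \<in> S} = 1"
    and X_int1: "integrable M (\<lambda>\<omega>. deriv p (X \<omega>) / p (X \<omega>))"
    and X_int2: "integrable M (\<lambda>\<omega>. deriv p (X \<omega>) / p (X \<omega>) * X \<omega>)"
  shows "distributed M lborel X (\<lambda>x. ennreal (p x)) \<longleftrightarrow>
    (\<forall>t>L. cdf (distr M borel X) t =
       (LINT \<omega>|M. - (deriv p (X \<omega>) / p (X \<omega>)) * (min (X \<omega>) t - L)))"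
proof -
  define K where "K = y ` {1..m}"
  have S: "S = {L<..} - K" by (simp add: S_def smooth_set_def K_def)
  have "finite K" by (simp add: K_def)
  then have "open S" unfolding S by (intro open_Diff finite_imp_closed) auto
  have [measurable]: "S \<in> sets borel" using \<open>open S\<close> by simp
  \<comment> \<open>the support, a closure, contains every point where \<open>p\<close> is positive\<close>
  have zero: "p x = 0" if "x < L" for x
  proof (rule ccontr)
    assume "p x \<noteq> 0"
    then have "x \<in> {x. 0 < p x}"
      using pdf by (auto simp: pdf_with_support_def order.strict_iff_order)
    then have "x \<in> {L..}"
      using pdf closure_subset[of "{x. 0 < p x}"] unfolding pdf_with_support_def by blast
    with that show False by simp
  qed
  interpret piecewise_C1_density p L K
    using pdf zero i_cont i_pos \<open>finite K\<close> C1_on_components_deriv[OF \<open>open S\<close>, of p] i_C1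
    by unfold_locales (auto simp: pdf_with_support_def S)
  define \<mu> where "\<mu> = distr M borel X"
  interpret M: prob_space M by (rule M)
  have "real_distribution \<mu>"
    unfolding \<mu>_def using X_rv by (rule M.real_distribution_distr)
  have X_AE: "AE \<omega> in M. X \<omega> \<in> S"
    using X_S X_rv by (subst M.prob_Collect_eq_1[symmetric]) auto
  have score: "neg_score x = - (deriv p x / p x)" if "x \<in> S" for x
    using that by (simp add: neg_score_def S)
  have "AE x in \<mu>. L < x"
    unfolding \<mu>_def using X_rv X_gt by (subst AE_distr_iff) auto
  have "integrable M (\<lambda>\<omega>. - (deriv p (X \<omega>) / p (X \<omega>)))"
    using X_int1 by (rule Bochner_Integration.integrable_minus)
  moreover have "AE \<omega> in M. - (deriv p (X \<omega>) / p (X \<omega>)) = neg_score (X \<omega>)"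
    using X_AE by eventually_elim (simp add: score)
  moreover have "(\<lambda>\<omega>. neg_score (X \<omega>)) \<in> borel_measurable M"
    using X_rv by measurable
  ultimately have "integrable M (\<lambda>\<omega>. neg_score (X \<omega>))"
    using integrable_cong_AE_imp by blast
  then have "integrable \<mu> neg_score"
    unfolding \<mu>_def using X_rv by (subst integrable_distr_eq) auto
  have rhs: "(LINT \<omega>|M. - (deriv p (X \<omega>) / p (X \<omega>)) * (min (X \<omega>) t - L)) =
      (LINT x|\<mu>. neg_score x * (min x t - L))" for t
  proof -
    have "(LINT x|\<mu>. neg_score x * (min x t - L)) = (LINT \<omega>|M. neg_score (X \<omega>) * (min (X \<omega>) t - L))"
      unfolding \<mu>_def using X_rv by (subst integral_distr) auto
    also have "\<dots> = (LINT \<omega>|M. - (deriv p (X \<omega>) / p (X \<omega>)) * (min (X \<omega>) t - L))"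
    proof (rule integral_cong_AE)
      show "AE \<omega> in M. neg_score (X \<omega>) * (min (X \<omega>) t - L) =
          - (deriv p (X \<omega>) / p (X \<omega>)) * (min (X \<omega>) t - L)"
        using X_AE by eventually_elim (simp add: score)
      show "(\<lambda>\<omega>. - (deriv p (X \<omega>) / p (X \<omega>)) * (min (X \<omega>) t - L)) \<in> borel_measurable M"
        using borel_measurable_integrable[OF X_int1] X_rv by measurable
    qed (use X_rv in measurable)
    finally show ?thesis by simp
  qed
  have "distr M lborel X = \<mu>" unfolding \<mu>_def by (rule distr_cong) auto
  then have "distributed M lborel X (\<lambda>x. ennreal (p x)) \<longleftrightarrow> \<mu> = density lborel (\<lambda>x. ennreal (p x))"
    using X_rv by (simp add: distributed_def)
  also have "\<dots> \<longleftrightarrow> (\<forall>t>L. cdf \<mu> t = (LINT x|\<mu>. neg_score x * (min x t - L)))"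
    by (rule density_iff_cdf_eq) fact+
  finally show ?thesis
    unfolding rhs \<mu>_def[symmetric] .
qed

end
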